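(* Every group of order $16$ that is not isomorphic to $\mathbb{Z}_2^4$ is unstable (that is, not stable).
   Context: Let $G$ be a finite group and let $A\subseteq G$ be a non-empty subset. A non-empty subset $B\subseteq G$ is called a (right) $s$-factor of $G$ associated with $A$ if every element $x\in AB=\{ab\mid a\in A,\ b\in B\}$ can be written uniquely as $x=ab$ with $a\in A$, $b\in B$, and $B$ is maximal with respect to inclusion among subsets with this property. The upper index $|G:A|^+$ and lower index $|G:A|^-$ are the sizes of a largest and of a smallest right $s$-factor of $G$ associated with $A$, respectively. The subset $A$ is called (right) stable in $G$ if $|G:A|^+=|G:A|^-$. The group $G$ is called (right) stable if all its non-empty subsets are right stable, and unstable otherwise. *)

theory Defs
  imports "HOL-Algebra.Algebra"
begin

definition unique_products :: "('a, 'm) monoid_scheme \<Rightarrow> 'a set \<Rightarrow> 'a set \<Rightarrow> bool" where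
  "unique_products G A B \<longleftrightarrow>
     (\<forall>x \<in> A <#>\<^bsub>G\<^esub> B. \<exists>!p. p \<in> A \<times> B \<and> x = fst p \<otimes>\<^bsub>G\<^esub> snd p)"

definition right_s_factor :: "('a, 'm) monoid_scheme \<Rightarrow> 'a set \<Rightarrow> 'a set \<Rightarrow> bool" where
  "right_s_factor G A B \<longleftrightarrow>
     B \<noteq> {} \<and> B \<subseteq> carrier G \<and> unique_products G A B \<and>
     (\<forall>C. C \<subseteq> carrier G \<and> unique_products G A C \<and> B \<subseteq> C \<longrightarrow> C = B)"

text \<open>The indices are meaningful for a finite group and a nonempty subset \<open>A\<close> of its carrier:
  there are then only finitely many s-factors, and at least one, since every singleton \<open>B\<close>
  has unique products with \<open>A\<close> and so extends to a maximal such set.\<close>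

definition upper_index :: "('a, 'm) monoid_scheme \<Rightarrow> 'a set \<Rightarrow> nat" where
  "upper_index G A = Max {card B | B. right_s_factor G A B}"

definition lower_index :: "('a, 'm) monoid_scheme \<Rightarrow> 'a set \<Rightarrow> nat" where
  "lower_index G A = Min {card B | B. right_s_factor G A B}"

definition right_stable_in :: "('a, 'm) monoid_scheme \<Rightarrow> 'a set \<Rightarrow> bool" where
  "right_stable_in G A \<longleftrightarrow> upper_index G A = lower_index G A"

definition stable_group :: "('a, 'm) monoid_scheme \<Rightarrow> bool" where
  "stable_group G \<longleftrightarrow> (\<forall>A. A \<noteq> {} \<and> A \<subseteq> carrier G \<longrightarrow> right_stable_in G A)"

definition unstable_group :: "('a, 'm) monoid_scheme \<Rightarrow> bool" where
  "unstable_group G \<longleftrightarrow> \<not> stable_group G"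

end

theory Submission
  imports Defs
begin

text \<open>
  A set \<open>B\<close> is an s-factor for \<open>A\<close> iff the translates \<open>A b\<close>, \<open>b \<in> B\<close>, are pairwise disjoint and
  every \<open>A y\<close> meets one of them. A group of order 16 has a central series with factors of
  order 2, so its elements are \<open>x\<^sub>1\<^sup>i x\<^sub>2\<^sup>j x\<^sub>3\<^sup>k x\<^sub>4\<^sup>l\<close> with exponents 0 and 1, and the multiplication in these
  coordinates is determined by ten bits: the squares of \<open>x\<^sub>2, x\<^sub>3, x\<^sub>4\<close> and the commutators of
  the generators with \<open>x\<^sub>3\<close> and \<open>x\<^sub>4\<close>. If all bits vanish, the group is elementary abelian. For each
  other choice of bits, either the table is not associative, or one of 23 triples
  \<open>(A, B, C)\<close> gives two s-factors \<open>B\<close> and \<open>C\<close> of different sizes for the same \<open>A\<close>.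
\<close>

section \<open>Central steps in a finite 2-group\<close>

context group
begin

text \<open>Class equation: conjugacy classes outside the centre have even size, so the centre has
  even order and contains some \<open>y \<noteq> \<one>\<close>. The last nontrivial iterated square
  of \<open>y\<close> is the involution.\<close>

lemma two_group_central_involution:
  assumes "order G = 2 ^ m" and "m > 0"
  shows "\<exists>z \<in> carrier G. z \<noteq> \<one> \<and> z \<otimes> z = \<one> \<and> (\<forall>g \<in> carrier G. g \<otimes> z = z \<otimes> g)"
proof -
  define \<phi> where "\<phi> = (\<lambda>g. (\<lambda>h \<in> carrier G. g \<otimes> h \<otimes> (inv g)))"
  interpret act: group_action G "carrier G" \<phi>
    unfolding \<phi>_def by (rule action_by_conjugation)
  define Z where "Z = {z \<in> carrier G. \<forall>g \<in> carrier G. g \<otimes> z = z \<otimes> g}"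
  have fin: "finite (carrier G)"
    using assms order_gt_0_iff_finite by simp
  have orbit_mem: "x \<in> orbit G \<phi> x" if "x \<in> carrier G" for x
    using act.orbit_refl[OF that] .
  have orbit_sub: "orbit G \<phi> x \<subseteq> carrier G" if "x \<in> carrier G" for x
    using that by (auto simp: orbit_def \<phi>_def)
  have singleton: "x \<in> Z" if x: "x \<in> carrier G" and "card (orbit G \<phi> x) = 1" for x
  proof -
    have "orbit G \<phi> x = {x}"
      using that orbit_mem[OF x] by (auto simp: card_1_singleton_iff)
    then have "g \<otimes> x \<otimes> inv g = x" if "g \<in> carrier G" for g
      using that x by (auto simp: orbit_def \<phi>_def)
    then have "g \<otimes> x = x \<otimes> g" if "g \<in> carrier G" for g
      using that x by (metis inv_solve_right m_closed)
    then show ?thesis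
      using x by (simp add: Z_def)
  qed
  have orbit_Z: "orbit G \<phi> x = {x}" if "x \<in> Z" for x
  proof -
    have "g \<otimes> x \<otimes> inv g = x" if "g \<in> carrier G" for g
      using that \<open>x \<in> Z\<close> unfolding Z_def by (simp add: m_assoc)
    then have "orbit G \<phi> x \<subseteq> {x}"
      using \<open>x \<in> Z\<close> by (auto simp: orbit_def \<phi>_def Z_def)
    then show ?thesis
      using orbit_mem[of x] \<open>x \<in> Z\<close> by (auto simp: Z_def)
  qed
  have even_orbit: "even (card (orbit G \<phi> x))" if "x \<in> carrier G - Z" for x
  proof -
    have "card (orbit G \<phi> x) dvd 2 ^ m"
      using act.orbit_stabilizer_theorem[of x] that assms by (metis DiffD1 dvd_triv_left)
    then obtain i where "card (orbit G \<phi> x) = 2 ^ i"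
      by (auto simp: divides_primepow_nat two_is_prime_nat)
    moreover have "card (orbit G \<phi> x) \<noteq> 1"
      using singleton that by auto
    ultimately show ?thesis
      by (cases i) auto
  qed
  have part: "partition (carrier G) (orbits G (carrier G) \<phi>)"
    by (rule act.orbit_partition)
  have disj: "A \<inter> B = {}" if "A \<in> orbits G (carrier G) \<phi>" "B \<in> orbits G (carrier G) \<phi>" "A \<noteq> B" for A B
    using partition.disjoint_union[OF part] that by blast
  \<comment> \<open>The noncentral conjugacy classes. They fill \<open>carrier G - Z\<close>: a
    class meeting \<open>Z\<close> would be the singleton class of a central element.\<close>
  define Os where "Os = orbits G (carrier G) \<phi> \<inter> {A. A \<subseteq> carrier G - Z}"
  have Un: "\<Union>Os = carrier G - Z"
  proof
    show "carrier G - Z \<subseteq> \<Union>Os"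
    proof
      fix x assume x: "x \<in> carrier G - Z"
      have "orbit G \<phi> x \<in> orbits G (carrier G) \<phi>"
        using x by (auto simp: orbits_def)
      moreover have "y \<notin> Z" if "y \<in> orbit G \<phi> x" for y
      proof
        assume y: "y \<in> Z"
        have "orbit G \<phi> y \<in> orbits G (carrier G) \<phi>"
          using y by (auto simp: orbits_def Z_def)
        then have "orbit G \<phi> x = {y}"
          using disj[of "orbit G \<phi> x" "orbit G \<phi> y"] that orbit_Z[OF y]
            \<open>orbit G \<phi> x \<in> orbits G (carrier G) \<phi>\<close> by auto
        then show False
          using orbit_mem[of x] x y by auto
      qed
      ultimately show "x \<in> \<Union>Os"
        using orbit_mem[of x] orbit_sub[of x] x by (auto simp: Os_def)
    qed
  qed (auto simp: Os_def)
  have finOs: "finite Os"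
    by (rule finite_subset[of _ "Pow (carrier G)"]) (use fin in \<open>auto simp: Os_def\<close>)
  have "card (carrier G - Z) = sum card Os"
    unfolding Un[symmetric]
  proof (rule card_Union_disjoint)
    show "pairwise disjnt Os"
      using disj by (auto simp: pairwise_def disjnt_def Os_def)
  qed (use fin in \<open>auto simp: Os_def intro: finite_subset\<close>)
  moreover have "even (card A)" if A: "A \<in> Os" for A
  proof -
    obtain x where "x \<in> carrier G" "A = orbit G \<phi> x"
      using A by (auto simp: Os_def orbits_def)
    then show ?thesis
      using even_orbit[of x] orbit_mem[of x] A by (auto simp: Os_def)
  qed
  ultimately have "even (card (carrier G - Z))"
    by (simp add: dvd_sum)
  moreover have "card (carrier G) = card Z + card (carrier G - Z)"
    using fin by (subst card_Un_disjoint[symmetric]) (auto simp: Z_def intro: arg_cong[where f = card])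
  moreover have "even (card (carrier G))"
    using assms by (simp add: order_def)
  ultimately have "even (card Z)"
    by simp
  moreover have "\<one> \<in> Z" "finite Z"
    using fin by (auto simp: Z_def)
  ultimately have "Z \<noteq> {\<one>}"
    by auto
  then obtain y where y: "y \<in> Z" "y \<noteq> \<one>"
    using \<open>\<one> \<in> Z\<close> by blast
  \<comment> \<open>The order of \<open>y\<close> is a power of 2, so such a \<open>j\<close>
    exists; it is positive since \<open>y \<noteq> \<one>\<close>, and by minimality the power with
    exponent \<open>2 ^ (j - 1)\<close> has order 2.\<close>
  define j where "j = (LEAST j. y [^] (2 ^ j :: nat) = \<one>)"
  have yc: "y \<in> carrier G"
    using y by (simp add: Z_def)
  have "y [^] (2 ^ m :: nat) = \<one>"
    using pow_order_eq_1[OF yc] assms by simp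
  then have yj: "y [^] (2 ^ j :: nat) = \<one>"
    unfolding j_def by (rule LeastI)
  have "j \<noteq> 0"
    using yj y yc by (cases j) auto
  then obtain i where i: "j = Suc i"
    by (cases j) auto
  define z where "z = y [^] (2 ^ i :: nat)"
  have "z \<noteq> \<one>"
    using not_less_Least[of i "\<lambda>j. y [^] (2 ^ j :: nat) = \<one>"] i by (simp add: z_def j_def)
  moreover have "z \<otimes> z = \<one>"
    using yj yc by (simp add: z_def i nat_pow_mult mult_2)
  moreover have "g \<otimes> z = z \<otimes> g" if "g \<in> carrier G" for g
    using y that group_commutes_pow[of y g] by (simp add: z_def Z_def)
  moreover have "z \<in> carrier G"
    using yc by (simp add: z_def)
  ultimately show ?thesis
    by blast
qed

text \<open>For normal \<open>N\<close>: the coset of \<open>x\<close> is a central element of order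
  2 in \<open>G Mod N\<close>. The formulation by elements of \<open>G\<close> supplies the
  correction factor \<open>n\<close> that becomes a table parameter later.\<close>

definition central_involution_mod :: "'a set \<Rightarrow> 'a \<Rightarrow> bool" where
  "central_involution_mod N x \<longleftrightarrow>
     x \<in> carrier G - N \<and> x \<otimes> x \<in> N \<and> (\<forall>g \<in> carrier G. \<exists>n \<in> N. g \<otimes> x = n \<otimes> x \<otimes> g)"

text \<open>The quotient is a nontrivial 2-group by Lagrange, so it has a central involution; any
  representative of that coset serves as \<open>x\<close>.\<close>

lemma two_group_central_involution_mod:
  assumes "order G = 2 ^ k" and "N \<lhd> G" and "N \<noteq> carrier G"
  shows "\<exists>x. central_involution_mod N x"
proof -
  interpret N: normal N G
    by fact
  interpret F: group "G Mod N"
    by (rule N.factorgroup_is_group)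
  have fin: "finite (carrier G)"
    using assms order_gt_0_iff_finite by simp
  have lag: "card (rcosets N) * card N = 2 ^ k"
    using lagrange[OF N.subgroup_axioms] assms(1) by simp
  then have "card (rcosets N) dvd 2 ^ k"
    by (metis dvd_triv_left)
  then obtain m where m: "card (rcosets N) = 2 ^ m"
    by (auto simp: divides_primepow_nat two_is_prime_nat)
  have "m \<noteq> 0"
  proof
    assume "m = 0"
    then have "card N = card (carrier G)"
      using lag m assms(1) by (simp add: order_def)
    then show False
      using assms(3) card_subset_eq[OF fin N.subset] by simp
  qed
  moreover have "order (G Mod N) = 2 ^ m"
    using m by (simp add: order_def FactGroup_def)
  ultimately have "\<exists>Z \<in> carrier (G Mod N). Z \<noteq> N \<and> Z <#> Z = N \<and> (\<forall>C \<in> carrier (G Mod N). C <#> Z = Z <#> C)"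
    using F.two_group_central_involution[of m] by (simp only: one_FactGroup mult_FactGroup)
  then obtain Z where Z: "Z \<in> carrier (G Mod N)" "Z \<noteq> N" "Z <#> Z = N"
    and comm: "\<forall>C \<in> carrier (G Mod N). C <#> Z = Z <#> C"
    by metis
  obtain x where x: "x \<in> carrier G" "Z = N #> x"
    using Z(1) by (auto simp: carrier_FactGroup)
  have "x \<notin> N"
    using Z(2) x(2) N.rcos_const[OF is_group, of x] by blast
  moreover have "x \<otimes> x \<in> N"
    using Z(3) N.rcos_sum[OF x(1) x(1)] rcos_self[OF _ N.subgroup_axioms, of "x \<otimes> x"] x(1)
    unfolding x(2) by simp
  moreover have "\<exists>n \<in> N. g \<otimes> x = n \<otimes> x \<otimes> g" if g: "g \<in> carrier G" for g
  proof -
    have "(N #> g) <#> Z = Z <#> (N #> g)"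
      using g by (intro comm[rule_format]) (simp add: carrier_FactGroup)
    then have "N #> (g \<otimes> x) = N #> (x \<otimes> g)"
      unfolding x(2) using x(1) g by (simp only: N.rcos_sum)
    then have "g \<otimes> x \<in> N #> (x \<otimes> g)"
      using rcos_self[OF _ N.subgroup_axioms, of "g \<otimes> x"] g x(1) by simp
    then obtain n where "n \<in> N" "g \<otimes> x = n \<otimes> (x \<otimes> g)"
      by (auto simp: r_coset_def)
    then show ?thesis
      using g x(1) N.mem_carrier[of n] by (intro bexI[of _ n]) (simp_all only: m_assoc)
  qed
  ultimately show ?thesis
    using x(1) unfolding central_involution_mod_def by blast
qed

text \<open>This union is the preimage of the subgroup of order 2 generated by the central coset
  \<open>N #> x\<close> in the quotient, and central subgroups are normal.\<close>

lemma normal_adjoin_central_involution: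
  assumes "N \<lhd> G" and "central_involution_mod N x"
  shows "N \<union> (N #> x) \<lhd> G"
proof -
  interpret N: normal N G
    by fact
  have x: "x \<in> carrier G" and xx: "x \<otimes> x \<in> N"
    and cen: "\<And>g. g \<in> carrier G \<Longrightarrow> \<exists>n \<in> N. g \<otimes> x = n \<otimes> x \<otimes> g"
    using assms(2) by (auto simp: central_involution_mod_def)
  have in_coset: "a \<in> N #> x \<longleftrightarrow> (\<exists>n \<in> N. a = n \<otimes> x)" for a
    by (auto simp: r_coset_def)
  \<comment> \<open>Moving \<open>x\<close> past any \<open>g\<close> costs only a factor in
    \<open>N\<close>; closure under products rests on this.\<close>
  have move: "\<exists>m \<in> N. n \<otimes> x \<otimes> g = m \<otimes> g \<otimes> x" if n: "n \<in> N" and g: "g \<in> carrier G" for n g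
  proof -
    obtain l where l: "l \<in> N" "g \<otimes> x = l \<otimes> x \<otimes> g"
      using cen g by blast
    then have "x \<otimes> g = inv l \<otimes> (g \<otimes> x)"
      using x n g N.mem_carrier by (subst inv_solve_left) (auto simp: m_assoc)
    then have "n \<otimes> x \<otimes> g = n \<otimes> inv l \<otimes> g \<otimes> x"
      using x n g l N.mem_carrier by (simp add: m_assoc)
    then show ?thesis
      using n l by (intro bexI[of _ "n \<otimes> inv l"]) auto
  qed
  have closed: "a \<otimes> b \<in> N \<union> (N #> x)" if "a \<in> N \<union> (N #> x)" "b \<in> N \<union> (N #> x)" for a b
  proof -
    have nx: "n \<otimes> x \<otimes> b \<in> N \<union> (N #> x)" if n: "n \<in> N" for n
    proof (cases "b \<in> N")
      case True
      then show ?thesis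
        using move[OF n, of b] in_coset by fastforce
    next
      case False
      then obtain l where l: "l \<in> N" "b = l \<otimes> x"
        using \<open>b \<in> _\<close> in_coset by auto
      obtain m where m: "m \<in> N" "n \<otimes> x \<otimes> l = m \<otimes> l \<otimes> x"
        using move[OF n, of l] l by auto
      have "n \<otimes> x \<otimes> b = m \<otimes> l \<otimes> (x \<otimes> x)"
        using m l n x N.mem_carrier by (simp add: m_assoc[symmetric])
      then show ?thesis
        using m l xx by auto
    qed
    have "n \<otimes> b \<in> N \<union> (N #> x)" if n: "n \<in> N" for n
    proof (cases "b \<in> N")
      case False
      then obtain l where l: "l \<in> N" "b = l \<otimes> x"
        using \<open>b \<in> _\<close> in_coset by auto
      then have "n \<otimes> b = n \<otimes> l \<otimes> x"
        using n x N.mem_carrier by (simp add: m_assoc)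
      then show ?thesis
        using n l in_coset by auto
    qed (use n in auto)
    then show ?thesis
      using nx \<open>a \<in> _\<close> in_coset by auto
  qed
  have inv_x: "inv x \<in> N \<union> (N #> x)"
  proof -
    have "inv x = inv (x \<otimes> x) \<otimes> x"
      using x by (simp add: inv_mult_group m_assoc)
    then show ?thesis
      using xx in_coset by auto
  qed
  have "subgroup (N \<union> (N #> x)) G"
  proof (rule subgroupI)
    fix a assume a: "a \<in> N \<union> (N #> x)"
    show "inv a \<in> N \<union> (N #> x)"
    proof (cases "a \<in> N")
      case False
      then obtain n where "n \<in> N" "a = n \<otimes> x"
        using a in_coset by auto
      then have "inv a = inv x \<otimes> inv n"
        using x N.mem_carrier by (simp add: inv_mult_group)
      then show ?thesis
        using closed[OF inv_x, of "inv n"] \<open>n \<in> N\<close> by auto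
    qed auto
  next
    show "N \<union> (N #> x) \<noteq> {}"
      using N.one_closed by blast
  qed (use closed x N.mem_carrier in_coset in auto)
  moreover have "g \<otimes> a \<otimes> inv g \<in> N \<union> (N #> x)" if g: "g \<in> carrier G" and a: "a \<in> N \<union> (N #> x)" for g a
  proof (cases "a \<in> N")
    case False
    then obtain n where n: "n \<in> N" "a = n \<otimes> x"
      using a in_coset by auto
    obtain l where l: "l \<in> N" "g \<otimes> x = l \<otimes> x \<otimes> g"
      using cen g by blast
    have cancel: "inv g \<otimes> (g \<otimes> y) = y" if "y \<in> carrier G" for y
      using g that by (simp add: m_assoc[symmetric])
    \<comment> \<open>Inserting \<open>inv g \<otimes> g\<close> separates the conjugate of
      \<open>n\<close>, which lies in \<open>N\<close> by normality, from
      \<open>g \<otimes> x\<close>, which equals \<open>l \<otimes> x \<otimes> g\<close>.\<close>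
    have "g \<otimes> a \<otimes> inv g = (g \<otimes> n \<otimes> inv g) \<otimes> (g \<otimes> x) \<otimes> inv g"
      using g n(1) x N.mem_carrier[OF n(1)] unfolding n(2)
      by (simp add: m_assoc cancel)
    also have "\<dots> = (g \<otimes> n \<otimes> inv g) \<otimes> l \<otimes> x"
      using g x N.mem_carrier[OF n(1)] N.mem_carrier[OF l(1)] unfolding l(2) by (simp add: m_assoc)
    finally show ?thesis
      using N.inv_op_closed2[OF g n(1)] l(1) in_coset by blast
  qed (use g N.inv_op_closed2 in auto)
  ultimately show ?thesis
    unfolding normal_inv_iff by blast
qed

end

section \<open>Coordinates along a central series\<close>

text \<open>
  If \<open>x\<close> is a central involution modulo \<open>N\<close>, then \<open>(u, i)\<close> stands for \<open>u x\<^sup>i\<close> with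
  \<open>u \<in> N\<close>. In \<open>ext f \<phi> s\<close> the product of \<open>N\<close> is \<open>f\<close>, conjugation by \<open>x\<close> is \<open>\<phi>\<close>, and
  \<open>s = x\<^sup>2\<close>; in \<open>tri f \<phi> c\<close> a further conjugation acts as \<open>\<phi>\<close> on \<open>N\<close> and maps \<open>x\<close> to \<open>c x\<close>.
\<close>

fun ext :: "('n \<Rightarrow> 'n \<Rightarrow> 'n) \<Rightarrow> ('n \<Rightarrow> 'n) \<Rightarrow> 'n \<Rightarrow> 'n \<times> bool \<Rightarrow> 'n \<times> bool \<Rightarrow> 'n \<times> bool" where
  "ext f \<phi> s (u, False) (v, j) = (f u v, j)"
| "ext f \<phi> s (u, True) (v, False) = (f u (\<phi> v), True)"
| "ext f \<phi> s (u, True) (v, True) = (f (f u (\<phi> v)) s, False)"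

fun tri :: "('n \<Rightarrow> 'n \<Rightarrow> 'n) \<Rightarrow> ('n \<Rightarrow> 'n) \<Rightarrow> 'n \<Rightarrow> 'n \<times> bool \<Rightarrow> 'n \<times> bool" where
  "tri f \<phi> c (u, False) = (\<phi> u, False)"
| "tri f \<phi> c (u, True) = (f (\<phi> u) c, True)"

context group
begin

text \<open>Labels the elements of a normal subgroup by a type, with \<open>f\<close> as the
  multiplication of labels. Normality is included because the next generator is chosen in the
  quotient.\<close>

definition coordinates :: "('n \<Rightarrow> 'n \<Rightarrow> 'n) \<Rightarrow> ('n \<Rightarrow> 'a) \<Rightarrow> bool" where
  "coordinates f w \<longleftrightarrow> inj w \<and> range w \<lhd> G \<and> (\<forall>u v. w (f u v) = w u \<otimes> w v)"

definition conjugation_coordinates :: "('n \<Rightarrow> 'a) \<Rightarrow> 'a \<Rightarrow> ('n \<Rightarrow> 'n) \<Rightarrow> bool" where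
  "conjugation_coordinates w g \<phi> \<longleftrightarrow> (\<forall>u. g \<otimes> w u = w (\<phi> u) \<otimes> g)"

fun adjoin :: "('n \<Rightarrow> 'a) \<Rightarrow> 'a \<Rightarrow> 'n \<times> bool \<Rightarrow> 'a" where
  "adjoin w x (u, i) = (if i then w u \<otimes> x else w u)"

lemma coordinates_closed: "coordinates f w \<Longrightarrow> w u \<in> carrier G"
  unfolding coordinates_def by (meson normal_imp_subgroup rangeI subgroup.mem_carrier)

lemma range_adjoin: "range (adjoin w x) = range w \<union> (range w #> x)"
proof
  show "range w \<union> (range w #> x) \<subseteq> range (adjoin w x)"
  proof
    fix a assume "a \<in> range w \<union> (range w #> x)"
    then obtain u where "a = w u \<or> a = w u \<otimes> x"
      by (auto simp: r_coset_def)
    then have "a = adjoin w x (u, False) \<or> a = adjoin w x (u, True)"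
      by simp
    then show "a \<in> range (adjoin w x)"
      by blast
  qed
qed (fastforce simp: r_coset_def)

text \<open>Labels stay distinct because \<open>x\<close> lies outside the subgroup. The product
  rule comes from moving \<open>x\<close> to the right past \<open>w v\<close> by \<phi> and
  replacing \<open>x \<otimes> x\<close> by \<open>w s\<close>.\<close>

lemma coordinates_adjoin:
  assumes "coordinates f w" and x: "central_involution_mod (range w) x"
    and s: "w s = x \<otimes> x" and \<phi>: "conjugation_coordinates w x \<phi>"
  shows "coordinates (ext f \<phi> s) (adjoin w x)"
proof -
  have inj: "inj w" and N: "range w \<lhd> G" and hom: "\<And>u v. w (f u v) = w u \<otimes> w v"
    using assms(1) by (auto simp: coordinates_def)
  interpret N: normal "range w" G
    by fact
  have xc: "x \<in> carrier G" and xN: "x \<notin> range w"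
    using x by (auto simp: central_involution_mod_def)
  have wc: "w u \<in> carrier G" for u
    using assms(1) by (rule coordinates_closed)
  have neq: "w u \<noteq> w v \<otimes> x" for u v
  proof
    assume "w u = w v \<otimes> x"
    then have "x = inv (w v) \<otimes> w u"
      using xc wc by (simp add: inv_solve_left)
    then have "x \<in> range w"
      using N.m_closed[OF N.m_inv_closed, of "w v" "w u"] by simp
    then show False
      using xN by contradiction
  qed
  have cancel: "w u \<otimes> x = w v \<otimes> x \<longleftrightarrow> u = v" for u v
    using xc wc inj by (simp add: inj_eq)
  have "inj (adjoin w x)"
  proof (rule injI)
    fix p q assume eq: "adjoin w x p = adjoin w x q"
    show "p = q"
      using eq by (cases p; cases q) (simp add: cancel neq neq[symmetric] inj_eq[OF inj] split: if_splits)
  qed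
  moreover have "adjoin w x (ext f \<phi> s p q) = adjoin w x p \<otimes> adjoin w x q" for p q
  proof -
    have conj: "x \<otimes> w v = w (\<phi> v) \<otimes> x" for v
      using \<phi> by (simp add: conjugation_coordinates_def)
    have 1: "w u \<otimes> x \<otimes> w v = w u \<otimes> w (\<phi> v) \<otimes> x" for u v
      using conj[of v] xc wc by (simp add: m_assoc)
    have 2: "w u \<otimes> x \<otimes> (w v \<otimes> x) = w u \<otimes> w (\<phi> v) \<otimes> (x \<otimes> x)" for u v
      using 1[of u v] xc wc by (simp add: m_assoc[symmetric])
    obtain u i v j where "p = (u, i)" "q = (v, j)"
      by (cases p; cases q)
    then show ?thesis
      using xc wc by (cases i; cases j) (simp_all add: hom s 1 2, simp_all add: m_assoc)
  qed
  moreover have "range (adjoin w x) \<lhd> G"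
    unfolding range_adjoin using N x by (rule normal_adjoin_central_involution)
  ultimately show ?thesis
    by (simp add: coordinates_def)
qed

text \<open>Centrality modulo the subgroup gives \<open>c\<close> with
  \<open>g \<otimes> x = w c \<otimes> x \<otimes> g\<close>; together with \<phi> this determines
  the conjugation on all products \<open>w u \<otimes> x\<close>.\<close>

lemma conjugation_coordinates_adjoin:
  assumes w: "coordinates f w" and x: "central_involution_mod (range w) x"
    and g: "g \<in> carrier G" and \<phi>: "conjugation_coordinates w g \<phi>"
  shows "\<exists>c. conjugation_coordinates (adjoin w x) g (tri f \<phi> c)"
proof -
  have xc: "x \<in> carrier G"
    using x by (auto simp: central_involution_mod_def)
  have wc: "w u \<in> carrier G" for u
    using w by (rule coordinates_closed)
  have hom: "w (f u v) = w u \<otimes> w v" for u v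
    using w by (simp add: coordinates_def)
  obtain c where c: "g \<otimes> x = w c \<otimes> x \<otimes> g"
    using x g by (auto simp: central_involution_mod_def)
  have gw: "g \<otimes> w u = w (\<phi> u) \<otimes> g" for u
    using \<phi> by (simp add: conjugation_coordinates_def)
  have "g \<otimes> (w u \<otimes> x) = w (\<phi> u) \<otimes> w c \<otimes> x \<otimes> g" for u
  proof -
    have "g \<otimes> (w u \<otimes> x) = w (\<phi> u) \<otimes> (g \<otimes> x)"
      using gw[of u] g xc wc by (metis m_assoc)
    then show ?thesis
      using g xc wc unfolding c by (simp add: m_assoc)
  qed
  then have "g \<otimes> adjoin w x p = adjoin w x (tri f \<phi> c p) \<otimes> g" for p
    using gw hom by (cases p; cases "snd p") simp_all
  then show ?thesis
    by (auto simp: conjugation_coordinates_def)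
qed

text \<open>The set \<Phi> lists candidate conjugation maps that cover all of \<open>G\<close>.
  Carrying it along bounds the possible tables: the next generator must act by a member of \<Phi>,
  and each member extends by one new parameter \<open>c\<close>.\<close>

lemma two_group_coordinates_step:
  fixes w :: "'n::finite \<Rightarrow> 'a"
  assumes "order G = 2 ^ k" and "card (UNIV :: 'n set) < 2 ^ k" and w: "coordinates f w"
    and conj: "\<forall>g \<in> carrier G. \<exists>\<phi> \<in> \<Phi>. conjugation_coordinates w g \<phi>"
  shows "\<exists>x s. \<exists>\<phi> \<in> \<Phi>. coordinates (ext f \<phi> s) (adjoin w x) \<and>
    (\<forall>g \<in> carrier G. \<exists>\<psi> \<in> {tri f \<psi> c | \<psi> c. \<psi> \<in> \<Phi>}. conjugation_coordinates (adjoin w x) g \<psi>)"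
proof -
  have "inj w" "range w \<lhd> G"
    using w by (auto simp: coordinates_def)
  moreover from this have "range w \<noteq> carrier G"
    using assms(1,2) card_image[of w UNIV] by (auto simp: order_def)
  ultimately obtain x where x: "central_involution_mod (range w) x"
    using two_group_central_involution_mod[OF assms(1)] by blast
  then have xc: "x \<in> carrier G" and "x \<otimes> x \<in> range w"
    by (auto simp: central_involution_mod_def)
  then obtain s where s: "w s = x \<otimes> x"
    by auto
  \<comment> \<open>The new generator is itself an element of \<open>G\<close>, so its conjugation
    map is already among the candidates.\<close>
  obtain \<phi> where \<phi>: "\<phi> \<in> \<Phi>" "conjugation_coordinates w x \<phi>"
    using conj xc by blast
  have "\<exists>\<psi> \<in> {tri f \<psi> c | \<psi> c. \<psi> \<in> \<Phi>}. conjugation_coordinates (adjoin w x) g \<psi>"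
    if g: "g \<in> carrier G" for g
  proof -
    obtain \<psi> where \<psi>: "\<psi> \<in> \<Phi>" "conjugation_coordinates w g \<psi>"
      using conj g by blast
    then obtain c where "conjugation_coordinates (adjoin w x) g (tri f \<psi> c)"
      using conjugation_coordinates_adjoin[OF w x g] by blast
    then show ?thesis
      using \<psi>(1) by (intro bexI[of _ "tri f \<psi> c"]) auto
  qed
  then show ?thesis
    using coordinates_adjoin[OF w x s \<phi>(2)] \<phi>(1)
    by (intro exI[of _ x] exI[of _ s] bexI[of _ \<phi>] conjI ballI)
qed

end

section \<open>Multiplication tables of the groups of order 16\<close>

type_synonym elt1 = "unit \<times> bool"
type_synonym elt2 = "elt1 \<times> bool"
type_synonym elt3 = "elt2 \<times> bool"
type_synonym elt4 = "elt3 \<times> bool"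

text \<open>The step above the trivial group: the one-point type admits only \<open>()\<close> as a
  square, so no bit is spent on the first generator.\<close>

definition table1 :: "elt1 \<Rightarrow> elt1 \<Rightarrow> elt1" where
  "table1 = ext (\<lambda>_ _. ()) id ()"

definition conj1 :: "elt1 \<Rightarrow> elt1" where
  "conj1 = tri (\<lambda>_ _. ()) id ()"

definition table2 :: "elt1 \<Rightarrow> elt2 \<Rightarrow> elt2 \<Rightarrow> elt2" where
  "table2 s2 = ext table1 conj1 s2"

definition conj2 :: "elt1 \<Rightarrow> elt2 \<Rightarrow> elt2" where
  "conj2 c = tri table1 conj1 c"

definition table3 :: "elt1 \<Rightarrow> elt1 \<Rightarrow> elt2 \<Rightarrow> elt3 \<Rightarrow> elt3 \<Rightarrow> elt3" where
  "table3 s2 c3 s3 = ext (table2 s2) (conj2 c3) s3"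

definition conj3 :: "elt1 \<Rightarrow> elt1 \<Rightarrow> elt2 \<Rightarrow> elt3 \<Rightarrow> elt3" where
  "conj3 s2 c d = tri (table2 s2) (conj2 c) d"

text \<open>Here \<open>s2\<close>, \<open>s3\<close>, \<open>s4\<close> are the squares of the
  generators, \<open>c3\<close> and \<open>c4\<close> the commutator factors of the second generator
  with the third and fourth, and \<open>d4\<close> that of the third with the fourth. Their bits
  number 1 + 1 + 2 + 1 + 2 + 3 = 10.\<close>

definition table4 :: "elt1 \<Rightarrow> elt1 \<Rightarrow> elt2 \<Rightarrow> elt1 \<Rightarrow> elt2 \<Rightarrow> elt3 \<Rightarrow> elt4 \<Rightarrow> elt4 \<Rightarrow> elt4" where
  "table4 s2 c3 s3 c4 d4 s4 = ext (table3 s2 c3 s3) (conj3 s2 c4 d4) s4"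

lemma card_UNIV_prod_bool: "card (UNIV :: ('n \<times> bool) set) = card (UNIV :: 'n set) * 2"
  by (simp add: UNIV_Times_UNIV[symmetric] card_cartesian_product del: UNIV_Times_UNIV)

text \<open>Four steps lead from the trivial subgroup to \<open>G\<close>, with candidate
  conjugations \<open>id\<close>, \<open>conj1\<close>, \<open>conj2 c\<close> and
  \<open>conj3 s2 c d\<close> in turn.\<close>

lemma (in group) order_16_coordinates:
  assumes "order G = 16"
  shows "\<exists>s2 c3 s3 c4 d4 s4 w. coordinates (table4 s2 c3 s3 c4 d4 s4) w \<and> range w = carrier G"
proof -
  note step = two_group_coordinates_step[where k = 4]
  have G: "order G = 2 ^ 4"
    using assms by simp
  have card0: "card (UNIV :: unit set) < 2 ^ 4"
    by simp
  have card1: "card (UNIV :: elt1 set) < 2 ^ 4" and card2: "card (UNIV :: elt2 set) < 2 ^ 4"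
    and card3: "card (UNIV :: elt3 set) < 2 ^ 4" and card4: "card (UNIV :: elt4 set) = 2 ^ 4"
    by (simp_all add: card_UNIV_prod_bool)
  have w0: "coordinates (\<lambda>_ _. ()) (\<lambda>_. \<one>)"
    using one_is_normal by (simp add: coordinates_def inj_def)
  have conj0: "\<forall>g \<in> carrier G. \<exists>\<phi> \<in> {id}. conjugation_coordinates (\<lambda>_ :: unit. \<one>) g \<phi>"
    by (simp add: conjugation_coordinates_def)
  obtain w1 where w1: "coordinates table1 w1"
    and "\<forall>g \<in> carrier G. \<exists>\<psi> \<in> {tri (\<lambda>_ _. ()) \<psi> c | \<psi> c. \<psi> \<in> {id}}. conjugation_coordinates w1 g \<psi>"
    using step[OF G card0 w0 conj0] unfolding table1_def by force
  then have conj1: "\<forall>g \<in> carrier G. \<exists>\<psi> \<in> {conj1}. conjugation_coordinates w1 g \<psi>"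
    by (auto simp: conj1_def)
  obtain s2 w2 where w2: "coordinates (table2 s2) w2"
    and "\<forall>g \<in> carrier G. \<exists>\<psi> \<in> {tri table1 \<psi> c | \<psi> c. \<psi> \<in> {conj1}}. conjugation_coordinates w2 g \<psi>"
    using step[OF G card1 w1 conj1] unfolding table2_def by blast
  then have conj2: "\<forall>g \<in> carrier G. \<exists>\<psi> \<in> range conj2. conjugation_coordinates w2 g \<psi>"
    unfolding conj2_def[abs_def] by blast
  obtain c3 s3 w3 where w3: "coordinates (table3 s2 c3 s3) w3"
    and "\<forall>g \<in> carrier G. \<exists>\<psi> \<in> {tri (table2 s2) \<psi> c | \<psi> c. \<psi> \<in> range conj2}. conjugation_coordinates w3 g \<psi>"
    using step[OF G card2 w2 conj2] unfolding table3_def by blast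
  then have conj3: "\<forall>g \<in> carrier G. \<exists>\<psi> \<in> {conj3 s2 c d | c d. True}. conjugation_coordinates w3 g \<psi>"
    unfolding conj3_def by blast
  obtain c4 d4 s4 w4 where w4: "coordinates (table4 s2 c3 s3 c4 d4 s4) w4"
    using step[OF G card3 w3 conj3] unfolding table4_def by blast
  \<comment> \<open>Sixteen distinct values exhaust a group of order 16.\<close>
  then have "inj w4"
    by (simp add: coordinates_def)
  then have "card (range w4) = card (carrier G)"
    using assms card4 by (simp add: card_image order_def)
  moreover have "range w4 \<subseteq> carrier G"
    using coordinates_closed[OF w4] by blast
  moreover have "finite (carrier G)"
    using assms order_gt_0_iff_finite by simp
  ultimately have "range w4 = carrier G"
    using card_subset_eq by blast
  then show ?thesis
    using w4 by blast
qed

section \<open>S-factors from the tables\<close>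

definition products :: "('n \<Rightarrow> 'n \<Rightarrow> 'n) \<Rightarrow> 'n list \<Rightarrow> 'n list \<Rightarrow> 'n list" where
  "products f A B = map (\<lambda>(a, b). f a b) (List.product A B)"

text \<open>To be used with \<open>P\<close> listing the products of \<open>A\<close> and
  \<open>B\<close>. As an argument, this list can be evaluated once before it is tested for
  distinctness and membership.\<close>

definition covers :: "('n \<Rightarrow> 'n \<Rightarrow> 'n) \<Rightarrow> 'n list \<Rightarrow> 'n list \<Rightarrow> 'n list \<Rightarrow> bool" where
  "covers f Y A P \<longleftrightarrow> distinct P \<and> (\<forall>y \<in> set Y. \<exists>a \<in> set A. f a y \<in> set P)"

definition s_factor_test :: "('n \<Rightarrow> 'n \<Rightarrow> 'n) \<Rightarrow> 'n list \<Rightarrow> 'n list \<Rightarrow> 'n list \<Rightarrow> bool" where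
  "s_factor_test f Y A B \<longleftrightarrow> covers f Y A (products f A B)"

text \<open>Distinct products give uniqueness. Maximality holds because every translate of
  \<open>A\<close> meets the product set, so an additional element would create a second
  factorization.\<close>

lemma (in group) right_s_factor_of_test:
  assumes w: "coordinates f w" and ran: "range w = carrier G" and Y: "set Y = UNIV" and test: "s_factor_test f Y A B"
  shows "right_s_factor G (w ` set A) (w ` set B)"
proof -
  have hom: "w a \<otimes> w b = w (f a b)" and inj: "w a = w b \<longleftrightarrow> a = b" for a b
    using w by (auto simp: coordinates_def inj_eq)
  have "inj_on (\<lambda>(a, b). f a b) (set A \<times> set B)"
    using test by (simp add: s_factor_test_def covers_def products_def distinct_map)
  then have uniq: "a = a' \<and> b = b'"
    if "f a b = f a' b'" "a \<in> set A" "a' \<in> set A" "b \<in> set B" "b' \<in> set B" for a a' b b'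
    using that by (auto dest: inj_onD[of _ _ "(a, b)" "(a', b')"])
  have cover: "\<exists>a \<in> set A. \<exists>a' \<in> set A. \<exists>b \<in> set B. f a y = f a' b" for y
    using test Y by (fastforce simp: s_factor_test_def covers_def products_def)
  have "unique_products G (w ` set A) (w ` set B)"
    unfolding unique_products_def
  proof
    fix x assume "x \<in> w ` set A <#> w ` set B"
    then obtain a b where ab: "a \<in> set A" "b \<in> set B" "x = w a \<otimes> w b"
      by (auto simp: set_mult_def)
    show "\<exists>!p. p \<in> w ` set A \<times> w ` set B \<and> x = fst p \<otimes> snd p"
    proof (rule ex1I[of _ "(w a, w b)"])
      fix p assume "p \<in> w ` set A \<times> w ` set B \<and> x = fst p \<otimes> snd p"
      then obtain a' b' where p: "p = (w a', w b')" "a' \<in> set A" "b' \<in> set B" "x = w a' \<otimes> w b'"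
        by auto
      then have "f a b = f a' b'"
        using ab by (simp add: hom inj)
      then show "p = (w a, w b)"
        using uniq ab p by blast
    qed (use ab in auto)
  qed
  moreover have "C = w ` set B"
    if C: "C \<subseteq> carrier G" "unique_products G (w ` set A) C" "w ` set B \<subseteq> C" for C
  proof
    show "C \<subseteq> w ` set B"
    proof
      fix c assume c: "c \<in> C"
      then obtain y where y: "c = w y"
        using C(1) ran by blast
      obtain a a' b where ab: "a \<in> set A" "a' \<in> set A" "b \<in> set B" "f a y = f a' b"
        using cover by blast
      \<comment> \<open>Both \<open>c\<close> and \<open>w b\<close> lie in \<open>C\<close>, so
        these are two factorizations over \<open>C\<close> and uniqueness there forces
        \<open>c = w b\<close>.\<close>
      then have "w a \<otimes> c = w a' \<otimes> w b"
        by (simp add: y hom)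
      moreover have "w a \<otimes> c \<in> w ` set A <#> C"
        using ab c by (auto simp: set_mult_def)
      then have "\<exists>!p. p \<in> w ` set A \<times> C \<and> w a \<otimes> c = fst p \<otimes> snd p"
        using C(2) by (simp add: unique_products_def)
      moreover have "(w a, c) \<in> w ` set A \<times> C" "(w a', w b) \<in> w ` set A \<times> C"
        using ab c C(3) by auto
      ultimately have "(w a, c) = (w a', w b)"
        by (metis fst_conv snd_conv)
      then show "c \<in> w ` set B"
        using ab by simp
    qed
  qed (use C in auto)
  moreover have "set B \<noteq> {}"
    using cover by auto
  moreover have "w ` set B \<subseteq> carrier G"
    using ran by auto
  ultimately show ?thesis
    unfolding right_s_factor_def by blast
qed

lemma not_right_stable_in:
  assumes "finite (carrier G)" and "right_s_factor G A B" and "right_s_factor G A C"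
    and "card B \<noteq> card C"
  shows "\<not> right_stable_in G A"
proof -
  define S where "S = {card B | B. right_s_factor G A B}"
  have "S \<subseteq> card ` Pow (carrier G)"
    by (auto simp: S_def right_s_factor_def)
  then have "finite S"
    using assms(1) finite_subset by blast
  moreover have "card B \<in> S" "card C \<in> S"
    using assms(2,3) by (auto simp: S_def)
  ultimately have "Min S \<le> card B" "card B \<le> Max S" "Min S \<le> card C" "card C \<le> Max S"
    by simp_all
  then show ?thesis
    using assms(4) by (auto simp: right_stable_in_def upper_index_def lower_index_def S_def[symmetric])
qed

section \<open>Certificates\<close>

text \<open>The bits of \<open>n\<close> are the exponents of the four generators, the first being the lowest.\<close>

definition elt :: "nat \<Rightarrow> elt4" where
  "elt n = (((((), odd n), odd (n div 2)), odd (n div 4)), odd (n div 8))"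

text \<open>Triples \<open>(A, B, C)\<close> found by a greedy computer search over the associative tables.\<close>

definition certificates :: "(nat list \<times> nat list \<times> nat list) list" where
  "certificates =
   [([0, 4, 8, 11], [0, 5], [0, 1, 6, 7]),
    ([0, 2, 5, 12], [0, 3], [0, 1, 10, 11]),
    ([0, 5, 6, 14], [0, 9], [0, 1, 12, 13]),
    ([0, 4, 8, 14], [0, 9], [0, 1, 2, 3]),
    ([0, 6, 10, 14], [0, 11], [0, 1, 2, 3]),
    ([0, 1, 6, 12], [0, 3], [0, 2, 9, 11]),
    ([0, 1, 6, 12], [0, 2], [0, 3, 8, 11]),
    ([0, 6, 10, 14], [0, 9, 11], [0, 1, 2, 3]),
    ([0, 4, 8, 11], [0, 10], [0, 1, 6, 7]),
    ([0, 5, 6, 14], [0, 15], [0, 1, 12, 13]),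
    ([0, 4, 8, 9], [0, 3], [0, 2, 5, 7]),
    ([0, 2, 5, 12], [0, 13], [0, 1, 10, 11]),
    ([0, 3, 6, 12], [0, 7], [0, 1, 8, 9]),
    ([0, 6, 12, 14], [0, 9], [0, 1, 4, 5]),
    ([0, 1, 2, 10], [0, 5], [0, 7, 9, 14]),
    ([0, 2, 5, 12], [0, 1], [0, 8, 11]),
    ([0, 1, 2, 8], [0, 5], [0, 4, 11, 15]),
    ([0, 1, 2, 8], [0, 5], [0, 6, 11, 13]),
    ([0, 1, 2, 8], [0, 6], [0, 5, 11, 14]),
    ([0, 1, 6, 8], [0, 2], [0, 3, 12, 15]),
    ([0, 1, 6, 12], [0, 14], [0, 2, 9]),
    ([0, 2, 5, 14], [0, 13], [0, 1, 8, 9]),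
    ([0, 2, 7, 8], [0, 6], [0, 1, 14, 15])]"

definition elts :: "elt4 list" where
  "elts = map elt [0, 1, 2, 3, 4, 5, 6, 7, 8, 9, 10, 11, 12, 13, 14, 15]"

text \<open>The label 1 appears as \<open>Suc 0\<close>, the form produced by
  \<open>One_nat_def\<close> during evaluation.\<close>

lemma elt_simps:
  "elt 0 = (((((), False), False), False), False)"
  "elt (Suc 0) = (((((), True), False), False), False)"
  "elt 2 = (((((), False), True), False), False)"
  "elt 3 = (((((), True), True), False), False)"
  "elt 4 = (((((), False), False), True), False)"
  "elt 5 = (((((), True), False), True), False)"
  "elt 6 = (((((), False), True), True), False)"
  "elt 7 = (((((), True), True), True), False)"
  "elt 8 = (((((), False), False), False), True)"
  "elt 9 = (((((), True), False), False), True)"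
  "elt 10 = (((((), False), True), False), True)"
  "elt 11 = (((((), True), True), False), True)"
  "elt 12 = (((((), False), False), True), True)"
  "elt 13 = (((((), True), False), True), True)"
  "elt 14 = (((((), False), True), True), True)"
  "elt 15 = (((((), True), True), True), True)"
  by (simp_all add: elt_def)

text \<open>Of the 1024 tables, 216 pass these five instances, and those are associative.\<close>

definition associativity_test :: "(elt4 \<Rightarrow> elt4 \<Rightarrow> elt4) \<Rightarrow> bool" where
  "associativity_test f \<longleftrightarrow>
     (\<forall>(i, j, k) \<in> set [(4, 4, 4), (8, 4, 4), (8, 8, 2), (8, 8, 4), (8, 8, 8)].
        f (f (elt i) (elt j)) (elt k) = f (elt i) (f (elt j) (elt k)))"

definition certified :: "(elt4 \<Rightarrow> elt4 \<Rightarrow> elt4) \<Rightarrow> bool" where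
  "certified f \<longleftrightarrow> (\<exists>(A, B, C) \<in> set certificates.
     s_factor_test f elts (map elt A) (map elt B) \<and> s_factor_test f elts (map elt A) (map elt C))"

text \<open>Conjugation disappears from the two lowest levels because \<open>conj1\<close> is the
  identity, the only automorphism of a group of order 2.\<close>

lemma table_simps:
  "table1 (u, a) (v, b) = ((), if a then \<not> b else b)"
  "table2 s2 (u1, False) (v1, j) = (table1 u1 v1, j)"
  "table2 s2 (u1, True) (v1, False) = (table1 u1 v1, True)"
  "table2 s2 (u1, True) (v1, True) = (table1 (table1 u1 v1) s2, False)"
  "conj2 c (u1, False) = (u1, False)"
  "conj2 c (u1, True) = (table1 u1 c, True)"
  "table3 s2 c3 s3 (u2, False) (v2, j) = (table2 s2 u2 v2, j)"
  "table3 s2 c3 s3 (u2, True) (v2, False) = (table2 s2 u2 (conj2 c3 v2), True)"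
  "table3 s2 c3 s3 (u2, True) (v2, True) = (table2 s2 (table2 s2 u2 (conj2 c3 v2)) s3, False)"
  "conj3 s2 c d (u2, False) = (conj2 c u2, False)"
  "conj3 s2 c d (u2, True) = (table2 s2 (conj2 c u2) d, True)"
  "table4 s2 c3 s3 c4 d4 s4 (u3, False) (v3, j) = (table3 s2 c3 s3 u3 v3, j)"
  "table4 s2 c3 s3 c4 d4 s4 (u3, True) (v3, False) = (table3 s2 c3 s3 u3 (conj3 s2 c4 d4 v3), True)"
  "table4 s2 c3 s3 c4 d4 s4 (u3, True) (v3, True) =
     (table3 s2 c3 s3 (table3 s2 c3 s3 u3 (conj3 s2 c4 d4 v3)) s4, False)"
proof -
  have "conj1 u = u" for u
    by (cases u; cases "snd u") (simp_all add: conj1_def)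
  then show "conj2 c (u1, False) = (u1, False)" "conj2 c (u1, True) = (table1 u1 c, True)"
    "table2 s2 (u1, True) (v1, False) = (table1 u1 v1, True)"
    "table2 s2 (u1, True) (v1, True) = (table1 (table1 u1 v1) s2, False)"
    by (simp_all add: table2_def conj2_def)
  show "table1 (u, a) (v, b) = ((), if a then \<not> b else b)"
    by (cases a; cases b) (simp_all add: table1_def)
qed (simp_all add: table2_def table3_def conj3_def table4_def)

text \<open>Rules for evaluation by the simplifier: conditions come first, and the weak congruence
  rules below keep it from working on branches and quantifier bodies that are not reached.\<close>

lemma lazy_simps:
  "P \<and> Q \<longleftrightarrow> (if P then Q else False)"
  "distinct [] \<longleftrightarrow> True"
  "distinct (x # xs) \<longleftrightarrow> (if x \<in> set xs then False else distinct xs)"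
  "x \<in> set [] \<longleftrightarrow> False"
  "x \<in> set (y # xs) \<longleftrightarrow> (if x = y then True else x \<in> set xs)"
  "(\<exists>x \<in> set []. R x) \<longleftrightarrow> False"
  "(\<exists>x \<in> set (y # xs). R x) \<longleftrightarrow> (if R y then True else \<exists>x \<in> set xs. R x)"
  "(\<forall>x \<in> set []. R x) \<longleftrightarrow> True"
  "(\<forall>x \<in> set (y # xs). R x) \<longleftrightarrow> (if R y then \<forall>x \<in> set xs. R x else False)"
  by auto

lemma flagged_eq:
  "(u, True) = (v, True) \<longleftrightarrow> u = v"
  "(u, False) = (v, False) \<longleftrightarrow> u = v"
  "(u, True) = (v, False) \<longleftrightarrow> False"
  "(u, False) = (v, True) \<longleftrightarrow> False"
  by auto

lemma weak_congs:
  "A = B \<Longrightarrow> Ball A R = Ball B R"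
  "A = B \<Longrightarrow> Bex A R = Bex B R"
  by simp_all

lemma set_elts: "set elts = UNIV"
proof -
  have "(((((), a), b), c), d) \<in> set elts" for a b c d
    by (cases a; cases b; cases c; cases d) (simp_all add: elts_def elt_simps)
  then show ?thesis
    by auto
qed

lemma all_unit: "(\<forall>x. P x) \<longleftrightarrow> P ()"
  by auto

text \<open>A finite check over the ten bits. The nested conditionals postpone the certificate
  search until a table has passed the associativity test and is not the trivial one.\<close>

lemma certificate_exists:
  "\<forall>s2 c3 s3 c4 d4 s4.
     if associativity_test (table4 s2 c3 s3 c4 d4 s4) then
       if s2 = ((), False) \<and> c3 = ((), False) \<and> s3 = (((), False), False) \<and>
          c4 = ((), False) \<and> d4 = (((), False), False) \<and> s4 = ((((), False), False), False)
       then True else certified (table4 s2 c3 s3 c4 d4 s4)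
     else True"
  \<comment> \<open>Splitting the quantifiers into single bits leaves one closed goal per table,
    1024 in all.\<close>
  by (simp only: split_paired_All all_bool_eq all_unit cong: if_weak_cong, intro conjI)
    (simp_all only: certified_def associativity_test_def s_factor_test_def covers_def
      products_def certificates_def elts_def table_simps elt_simps lazy_simps
      flagged_eq prod.case simp_thms if_True if_False
      List.product.simps list.map append.simps One_nat_def
      cong: if_weak_cong weak_congs)

lemma certificate_cards:
  "(A, B, C) \<in> set certificates \<Longrightarrow> card (elt ` set B) \<noteq> card (elt ` set C)"
  unfolding certificates_def by (auto simp: elt_simps card_insert_if)

section \<open>The trivial table and the elementary abelian group\<close>

lemma elt4_cases:
  obtains a b c d where "(x :: elt4) = (((((), a), b), c), d)"
  by (cases x) auto

lemma table4_trivial: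
  "table4 ((), False) ((), False) (((), False), False) ((), False) (((), False), False)
     ((((), False), False), False) (((((), a), b), c), d) (((((), a'), b'), c'), d') =
   (((((), a \<noteq> a'), b \<noteq> b'), c \<noteq> c'), d \<noteq> d')"
  by (cases a; cases b; cases c; cases d; cases a'; cases b'; cases c'; cases d')
    (simp_all add: table1_def conj1_def table2_def conj2_def table3_def conj3_def table4_def)

text \<open>With all bits zero the table is coordinatewise exclusive or, which is addition modulo 2
  once truth values are read as 0 and 1; the isomorphism is this reading after the inverse of
  \<open>w\<close>.\<close>

lemma (in group) elementary_abelian_16:
  assumes w: "coordinates (table4 ((), False) ((), False) (((), False), False) ((), False)
      (((), False), False) ((((), False), False), False)) w"
    and ran: "range w = carrier G"
  shows "G \<cong> integer_mod_group 2 \<times>\<times> integer_mod_group 2 \<times>\<times>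
             integer_mod_group 2 \<times>\<times> integer_mod_group 2"
    (is "G \<cong> ?V")
proof -
  define e :: "elt4 \<Rightarrow> int \<times> int \<times> int \<times> int"
    where "e = (\<lambda>((((_, a), b), c), d). (of_bool a, of_bool b, of_bool c, of_bool d))"
  have inj: "inj w" and hom: "w (table4 ((), False) ((), False) (((), False), False) ((), False)
      (((), False), False) ((((), False), False), False) u v) = w u \<otimes> w v" for u v
    using w unfolding coordinates_def by blast+
  have two: "i \<in> carrier (integer_mod_group 2) \<longleftrightarrow> i = 0 \<or> i = 1" for i
    by (auto simp: carrier_integer_mod_group)
  \<comment> \<open>Inverse to \<open>e\<close> on the carrier only: every integer other than 1 is
    read as \<open>False\<close>.\<close>
  define e' :: "int \<times> int \<times> int \<times> int \<Rightarrow> elt4"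
    where "e' = (\<lambda>(a, b, c, d). (((((), a = 1), b = 1), c = 1), d = 1))"
  have "e' (e p) = p" for p
    by (rule elt4_cases[of p]) (simp add: e_def e'_def)
  moreover have e_carrier: "e p \<in> carrier ?V" for p
    by (rule elt4_cases[of p]) (simp add: e_def two)
  moreover have "e (e' q) = q" if "q \<in> carrier ?V" for q
  proof -
    have "of_bool (i = 1) = i" if "i \<in> carrier (integer_mod_group 2)" for i
      using that by (auto simp: two)
    then show ?thesis
      using that by (cases q) (simp add: e_def e'_def)
  qed
  ultimately have "bij_betw e UNIV (carrier ?V)"
    by (intro bij_betw_byWitness[where f' = e']) blast+
  moreover have w_bij: "bij_betw w UNIV (carrier G)"
    using inj ran by (simp add: bij_betw_def)
  ultimately have "bij_betw (e \<circ> inv_into UNIV w) (carrier G) (carrier ?V)"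
    using bij_betw_inv_into bij_betw_trans by blast
  moreover have "e \<circ> inv_into UNIV w \<in> hom G ?V"
  proof (rule homI)
    fix x y assume "x \<in> carrier G" "y \<in> carrier G"
    then obtain u v where uv: "x = w u" "y = w v"
      using ran by blast
    obtain a b c d a' b' c' d' where
      abcd: "u = (((((), a), b), c), d)" "v = (((((), a'), b'), c'), d')"
      by (rule elt4_cases[of u], rule elt4_cases[of v])
    have inv_w: "inv_into UNIV w (w z) = z" for z
      using inj by (rule inv_into_f_f) simp
    have "x \<otimes> y = w (((((), a \<noteq> a'), b \<noteq> b'), c \<noteq> c'), d \<noteq> d')"
      unfolding uv abcd hom[symmetric] table4_trivial ..
    then show "(e \<circ> inv_into UNIV w) (x \<otimes> y) =
        (e \<circ> inv_into UNIV w) x \<otimes>\<^bsub>?V\<^esub> (e \<circ> inv_into UNIV w) y"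
      unfolding uv abcd comp_def by (simp add: inv_w e_def)
  qed (use e_carrier in simp)
  ultimately show ?thesis
    unfolding is_iso_def iso_def by blast
qed

section \<open>Instability of the groups with a nontrivial table\<close>

theorem lemma15:
  fixes G :: "('a, 'm) monoid_scheme"
  assumes "group G"
    and "order G = 16"
    and "\<not> G \<cong> integer_mod_group 2 \<times>\<times> integer_mod_group 2 \<times>\<times>
               integer_mod_group 2 \<times>\<times> integer_mod_group 2"
  shows "unstable_group G"
proof -
  interpret group G
    by fact
  obtain s2 c3 s3 c4 d4 s4 w
    where w: "coordinates (table4 s2 c3 s3 c4 d4 s4) w" and ran: "range w = carrier G"
    using order_16_coordinates[OF assms(2)] by metis
  define f where "f = table4 s2 c3 s3 c4 d4 s4"
  have wf: "coordinates f w"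
    using w by (simp add: f_def)
  have hom: "w (f u v) = w u \<otimes>\<^bsub>G\<^esub> w v" and inj: "inj w" for u v
    using wf unfolding coordinates_def by blast+
  \<comment> \<open>Associativity passes from \<open>G\<close> to the labels because
    \<open>w\<close> is injective; this discards the tables that belong to no group.\<close>
  have "f (f u v) z = f u (f v z)" for u v z
  proof -
    have "w (f (f u v) z) = w (f u (f v z))"
      unfolding hom by (intro m_assoc coordinates_closed[OF wf])
    then show ?thesis
      by (rule injD[OF inj])
  qed
  then have "associativity_test f"
    by (simp add: associativity_test_def)
  \<comment> \<open>The trivial table would make \<open>G\<close> elementary abelian, contrary to
    the hypothesis.\<close>
  moreover have "\<not> (s2 = ((), False) \<and> c3 = ((), False) \<and> s3 = (((), False), False) \<and>
      c4 = ((), False) \<and> d4 = (((), False), False) \<and> s4 = ((((), False), False), False))"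
    using elementary_abelian_16[of w] w ran assms(3) by blast
  ultimately have "certified f"
    using certificate_exists[rule_format, of s2 c3 s3 c4 d4 s4] unfolding f_def by (simp only: if_True if_False)
  then obtain A B C where cert: "(A, B, C) \<in> set certificates"
    and test: "s_factor_test f elts (map elt A) (map elt B)" "s_factor_test f elts (map elt A) (map elt C)"
    by (auto simp: certified_def)
  let ?A = "w ` set (map elt A)" and ?B = "w ` set (map elt B)" and ?C = "w ` set (map elt C)"
  have B: "right_s_factor G ?A ?B" and C: "right_s_factor G ?A ?C"
    using right_s_factor_of_test[OF wf ran set_elts] test by blast+
  have "card ?B \<noteq> card ?C"
    using certificate_cards[OF cert] by (simp add: card_image inj_on_subset[OF inj])
  moreover have "finite (carrier G)"
    using assms(2) order_gt_0_iff_finite by simp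
  ultimately have "\<not> right_stable_in G ?A"
    using B C not_right_stable_in by blast
  moreover have "?A \<noteq> {}"
    \<comment> \<open>Covering any label requires some element of \<open>A\<close>, so
      \<open>A\<close> cannot be empty.\<close>
    using test(1) by (auto simp: s_factor_test_def covers_def set_elts)
  moreover have "?A \<subseteq> carrier G"
    using ran by auto
  ultimately have "\<exists>A. A \<noteq> {} \<and> A \<subseteq> carrier G \<and> \<not> right_stable_in G A"
    by (intro exI[of _ ?A] conjI)
  then show ?thesis
    by (simp add: unstable_group_def stable_group_def)
qed

end
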